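(* Let $\Gamma$ be a finite graph with vertex set $\{1,\dots,n\}$ and let $Q$ be any acyclic orientation of $\Gamma$. Let $C_q$ be the $q$-Cartan matrix of $Q$ and $\Phi_q$ the $q$-Coxeter matrix of $Q$ (formed with any admissible numbering of $Q$). Then $$C_q^{T}=-\Phi_q C_q,$$ or equivalently $\Phi_q=-C_q^{T}C_q^{-1}$.
   Context: Let $q$ be an indeterminate and $\Bbbk$ an algebraically closed field. A quiver is a finite directed graph $Q=(Q_0,Q_1)$ (multiple arrows allowed); $s(\alpha),t(\alpha)$ denote the start and end vertex of an arrow $\alpha$. It is acyclic if it has no oriented cycles. $Q$ is an orientation of its underlying graph $\Gamma$; here $Q_0=\Gamma_0=\{1,\dots,n\}$. $q$-Cartan matrix of $Q$: the $n\times n$ matrix $C_q=(c_{ij}(q))$ over $\mathbb{Z}[q]$ with $c_{ij}(q)=\sum_{m\ge 0}\dim_{\Bbbk}(e_i\,\Bbbk Q\,e_j)_m\,q^m$. Here $\Bbbk Q$ is the path algebra (product of paths $p$ and $p'$ is the concatenation $pp'$ if the end of $p$ is the start of $p'$, and zero otherwise), graded by path length, and $e_i$ is the trivial path at $i$. So the coefficient of $q^m$ in $c_{ij}(q)$ is the number of oriented paths of length $m$ from $i$ to $j$. The matrix $C_q$ is invertible over $\mathbb{Z}[q]$. $q$-reflections: for vertices $i\neq j$ let $a_{ij}=a_{ji}$ be the number of edges of $\Gamma$ between $i$ and $j$; let $\Gamma_0(i)$ be the set of neighbours of $i$ (vertices joined to $i$ by an edge). Let $\mathbf{e}_1,\dots,\mathbf{e}_n$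 be the canonical basis of $\mathbb{Z}^n$. For $\mathbf{x}=\sum_k x_k\mathbf{e}_k$ put $$s_{i,q}(\mathbf{x})=\mathbf{x}+q\sum_{j\in\Gamma_0(i)}a_{ji}x_j\,\mathbf{e}_i-2x_i\mathbf{e}_i\in\mathbb{Z}[q]^n,$$ extended $\mathbb{Z}[q]$-linearly to $\mathbb{Z}[q]^n$. Let $S_i$ be the matrix of $s_{i,q}$ in the canonical basis (its $j$-th column is the coordinate vector of $s_{i,q}(\mathbf{e}_j)$). Admissible numbering of $Q$: an ordering $(a_1,\dots,a_n)$ of $Q_0$ such that $a_1$ is a sink of $Q$ and, for each $k\ge 2$, $a_k$ is a sink of the full subquiver of $Q$ on $Q_0\setminus\{a_1,\dots,a_{k-1}\}$. $q$-Coxeter matrix of $Q$: $\Phi_q=S_{a_1}\cdots S_{a_{n-1}}S_{a_n}$ for an admissible numbering $(a_1,\dots,a_n)$ of $Q$. It does not depend on the admissible numbering chosen. *)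

theory Defs
  imports
    "HOL-Analysis.Cartesian_Space"
    "HOL-Computational_Algebra.Polynomial"
    "HOL-Library.Poly_Mapping"
    "Graph_Theory.Digraph_Component"
    "Graph_Theory.Arc_Walk"
begin

section \<open>Graphs, orientations, acyclic quivers\<close>

text \<open>
  The vertex set of a graph is the whole type \<open>'v\<close>, which is later a finite type \<open>'n\<close> playing the
  role of \<open>{1,\<dots>,n}\<close>.  An edge has an identity of its own, so parallel edges are possible; the set
  of its endpoints has two elements, or one element for a loop.  (A graph with a loop has no
  acyclic orientation.)
\<close>

record ('v, 'e) multigraph =
  edges :: "'e set"
  ends :: "'e \<Rightarrow> 'v set"

definition finite_multigraph :: "('v::finite, 'e) multigraph \<Rightarrow> bool" where
  "finite_multigraph \<Gamma> \<longleftrightarrow> finite (edges \<Gamma>) \<and> (\<forall>e\<in>edges \<Gamma>. card (ends \<Gamma> e) \<in> {1, 2})"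

definition edge_count :: "('v, 'e) multigraph \<Rightarrow> 'v \<Rightarrow> 'v \<Rightarrow> nat" where
  "edge_count \<Gamma> i j = card {e \<in> edges \<Gamma>. ends \<Gamma> e = {i, j}}"

definition neighbours :: "('v, 'e) multigraph \<Rightarrow> 'v \<Rightarrow> 'v set" where
  "neighbours \<Gamma> i = {j. j \<noteq> i \<and> (\<exists>e\<in>edges \<Gamma>. ends \<Gamma> e = {i, j})}"

text \<open>A quiver is a \<^typ>\<open>('v, 'e) pre_digraph\<close>; \<open>tail\<close> is the start and \<open>head\<close> the end of an arrow.\<close>

definition orientation_of :: "('v, 'e) pre_digraph \<Rightarrow> ('v, 'e) multigraph \<Rightarrow> bool" where
  "orientation_of Q \<Gamma> \<longleftrightarrow> verts Q = UNIV \<and> arcs Q = edges \<Gamma> \<and>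
     (\<forall>e\<in>arcs Q. ends \<Gamma> e = {tail Q e, head Q e})"

definition acyclic_quiver :: "('v, 'e) pre_digraph \<Rightarrow> bool" where
  "acyclic_quiver Q \<longleftrightarrow> \<not> (\<exists>u p. p \<noteq> [] \<and> pre_digraph.awalk Q u p u)"

section \<open>The path algebra and the \<open>q\<close>-Cartan matrix\<close>

text \<open>
  A path is a pair of its start vertex and its list of arrows, so that \<open>(i, [])\<close> is the trivial
  path at \<open>i\<close>.  Elements of the path algebra are finitely supported functions from paths to the
  field.  The default multiplication of \<^typ>\<open>'a \<Rightarrow>\<^sub>0 'b\<close> is not used.
\<close>

type_synonym ('v, 'e) qpath = "'v \<times> 'e list"

definition qpaths :: "('v, 'e) pre_digraph \<Rightarrow> ('v, 'e) qpath set" where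
  "qpaths Q = {(u, p). \<exists>v. pre_digraph.awalk Q u p v}"

definition path_algebra :: "('v, 'e) pre_digraph \<Rightarrow> (('v, 'e) qpath \<Rightarrow>\<^sub>0 'k::field) set" where
  "path_algebra Q = {x. Poly_Mapping.keys x \<subseteq> qpaths Q}"

definition path_mult :: "('v, 'e) pre_digraph \<Rightarrow> (('v, 'e) qpath \<Rightarrow>\<^sub>0 'k::field) \<Rightarrow>
    (('v, 'e) qpath \<Rightarrow>\<^sub>0 'k) \<Rightarrow> (('v, 'e) qpath \<Rightarrow>\<^sub>0 'k)" where
  "path_mult Q x y =
     (\<Sum>(u, p)\<in>Poly_Mapping.keys x. \<Sum>(v, r)\<in>Poly_Mapping.keys y.
        if pre_digraph.awlast Q u p = v
        then Poly_Mapping.single (u, p @ r) (Poly_Mapping.lookup x (u, p) * Poly_Mapping.lookup y (v, r))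
        else 0)"

definition trivial_path :: "'v \<Rightarrow> (('v, 'e) qpath \<Rightarrow>\<^sub>0 'k::field)" where
  "trivial_path i = Poly_Mapping.single (i, []) 1"

definition path_scale :: "'k::field \<Rightarrow> ('p \<Rightarrow>\<^sub>0 'k) \<Rightarrow> ('p \<Rightarrow>\<^sub>0 'k)" where
  "path_scale c x = Poly_Mapping.map ((*) c) x"

lemma lookup_path_scale:
  "Poly_Mapping.lookup (path_scale c x) w = c * Poly_Mapping.lookup x w"
  by (simp add: path_scale_def Poly_Mapping.map.rep_eq when_def)

global_interpretation path_space: vector_space path_scale
  by standard
    (auto intro!: poly_mapping_eqI simp: lookup_path_scale lookup_add algebra_simps)

text \<open>\<open>peirce_component Q i j m\<close> is \<open>(e\<^sub>i kQ e\<^sub>j)\<^sub>m\<close>, graded by path length.\<close>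

definition peirce_component ::
    "('v, 'e) pre_digraph \<Rightarrow> 'v \<Rightarrow> 'v \<Rightarrow> nat \<Rightarrow> (('v, 'e) qpath \<Rightarrow>\<^sub>0 'k::field) set" where
  "peirce_component Q i j m =
     {y. (\<exists>x\<in>path_algebra Q. y = path_mult Q (path_mult Q (trivial_path i) x) (trivial_path j)) \<and>
         (\<forall>(u, p)\<in>Poly_Mapping.keys y. length p = m)}"

text \<open>
  \<open>\<int>[q]\<close> is \<^typ>\<open>int poly\<close>.  The field is passed as a type argument.  \<^const>\<open>Sum_any\<close> sums over all
  \<open>m\<close> with nonzero summand; for an acyclic finite quiver there are only finitely many of them.
\<close>

definition q_cartan :: "'k::field itself \<Rightarrow> ('n::finite, 'e) pre_digraph \<Rightarrow> int poly ^ 'n ^ 'n" where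
  "q_cartan _ Q = (\<chi> i j. Sum_any (\<lambda>m::nat.
     monom (int (path_space.dim (peirce_component Q i j m :: (('n, 'e) qpath \<Rightarrow>\<^sub>0 'k) set))) m))"

section \<open>\<open>q\<close>-reflections and the \<open>q\<close>-Coxeter matrix\<close>

definition q_indet :: "int poly" where
  "q_indet = monom 1 1"

definition q_reflection ::
    "('n::finite, 'e) multigraph \<Rightarrow> 'n \<Rightarrow> int poly ^ 'n \<Rightarrow> int poly ^ 'n" where
  "q_reflection \<Gamma> i x =
     x + q_indet *s (\<Sum>j\<in>neighbours \<Gamma> i. (of_nat (edge_count \<Gamma> j i) * x $ j) *s axis i 1)
       - (2 * x $ i) *s axis i 1"

definition q_reflection_matrix ::
    "('n::finite, 'e) multigraph \<Rightarrow> 'n \<Rightarrow> int poly ^ 'n ^ 'n" where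
  "q_reflection_matrix \<Gamma> i = matrix (q_reflection \<Gamma> i)"

definition is_sink :: "('v, 'e) pre_digraph \<Rightarrow> 'v \<Rightarrow> bool" where
  "is_sink Q v \<longleftrightarrow> v \<in> verts Q \<and> out_arcs Q v = {}"

text \<open>
  With 0-based lists, \<open>as ! k\<close> must be a sink after the removal of its \<open>k\<close> predecessors in \<open>as\<close>.
\<close>

definition admissible_numbering :: "('v, 'e) pre_digraph \<Rightarrow> 'v list \<Rightarrow> bool" where
  "admissible_numbering Q as \<longleftrightarrow> distinct as \<and> set as = verts Q \<and>
     (\<forall>k<length as. is_sink (Q \<restriction> (verts Q - set (take k as))) (as ! k))"

definition q_coxeter :: "('n::finite, 'e) multigraph \<Rightarrow> 'n list \<Rightarrow> int poly ^ 'n ^ 'n" where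
  "q_coxeter \<Gamma> as = foldr (\<lambda>a M. q_reflection_matrix \<Gamma> a ** M) as (mat 1)"

end

theory Submission
  imports Defs
begin

text \<open>
  Let \<open>A\<close> be the matrix whose entry \<open>A\<^sub>i\<^sub>j\<close> is the number of arrows from \<open>i\<close> to \<open>j\<close>, and put
  \<open>M = 1 - qA\<close>.  Everything follows from two facts: \<open>M\<close> is the inverse of the \<open>q\<close>-Cartan matrix
  \<open>C\<close>, and \<open>M\<^sup>T \<Phi> = - M\<close>.  Indeed, transposing \<open>M C = 1\<close> gives \<open>C\<^sup>T M\<^sup>T = 1\<close>, so the second fact
  yields \<open>\<Phi> = - C\<^sup>T M = - C\<^sup>T C\<^sup>-\<^sup>1\<close>.

  The first fact holds because the paths from \<open>i\<close> to \<open>j\<close> are a basis of \<open>e\<^sub>i kQ e\<^sub>j\<close>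
  (\<open>coeff_q_cartan\<close>), and splitting a path of positive length after its first arrow says
  \<open>C = 1 + qA C\<close> (\<open>euler_matrix_mult_q_cartan\<close>).  The other product \<open>C M = 1\<close> uses that arrows strictly
  decrease a height function on the vertices, so that \<open>M\<close> is unitriangular and can be cancelled.

  For the second fact, let \<open>y = \<Phi> x\<close>.  In computing \<open>y\<close> the reflections act from the last vertex of
  the numbering to the first, each of them changing a single coordinate.  When the reflection at
  \<open>i\<close> acts, the coordinates at vertices after \<open>i\<close> are already those of \<open>y\<close>, all the others
  still those of \<open>x\<close>.  In an admissible numbering arrows go from later to earlier vertices, so an
  edge at \<open>i\<close> is an arrow into \<open>i\<close> if its other end comes later, and out of \<open>i\<close> otherwise.  Hence
  \<open>y\<^sub>i = - x\<^sub>i + q \<Sum>\<^sub>l A\<^sub>l\<^sub>i y\<^sub>l + q \<Sum>\<^sub>l A\<^sub>i\<^sub>l x\<^sub>l\<close>, that is, \<open>(1 - q A\<^sup>T) y = - (1 - q A) x\<close>.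
\<close>

section \<open>The \<open>q\<close>-Cartan matrix counts paths\<close>

definition walks :: "('v, 'e) pre_digraph \<Rightarrow> 'v \<Rightarrow> 'v \<Rightarrow> nat \<Rightarrow> 'e list set" where
  "walks Q i j m = {p. pre_digraph.awalk Q i p j \<and> length p = m}"

lemma lookup_trivial_path_mult_left:
  "Poly_Mapping.lookup (path_mult Q (trivial_path i) x) (u, p)
     = (if u = i then Poly_Mapping.lookup x (u, p) else 0)"
proof -
  have "path_mult Q (trivial_path i) x = (\<Sum>w\<in>Poly_Mapping.keys x.
      if fst w = i then Poly_Mapping.single w (Poly_Mapping.lookup x w) else 0)"
    unfolding path_mult_def trivial_path_def
    by (auto simp: pre_digraph.awalk_verts.simps case_prod_beta intro!: sum.cong)
  then have "Poly_Mapping.lookup (path_mult Q (trivial_path i) x) (u, p)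
      = (\<Sum>w\<in>Poly_Mapping.keys x. if w = (u, p)
           then (if u = i then Poly_Mapping.lookup x w else 0) else 0)"
    by (simp only: lookup_sum) (intro sum.cong refl, auto simp: lookup_single when_def)
  then show ?thesis
    by (auto simp: in_keys_iff)
qed

lemma lookup_trivial_path_mult_right:
  "Poly_Mapping.lookup (path_mult Q x (trivial_path j)) (u, p)
     = (if pre_digraph.awlast Q u p = j then Poly_Mapping.lookup x (u, p) else 0)"
proof -
  have "path_mult Q x (trivial_path j) = (\<Sum>w\<in>Poly_Mapping.keys x.
      if pre_digraph.awlast Q (fst w) (snd w) = j
      then Poly_Mapping.single w (Poly_Mapping.lookup x w) else 0)"
    unfolding path_mult_def trivial_path_def
    by (auto simp: case_prod_beta intro!: sum.cong)
  then have "Poly_Mapping.lookup (path_mult Q x (trivial_path j)) (u, p)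
      = (\<Sum>w\<in>Poly_Mapping.keys x. if w = (u, p)
           then (if pre_digraph.awlast Q u p = j then Poly_Mapping.lookup x w else 0) else 0)"
    by (simp only: lookup_sum) (intro sum.cong refl, auto simp: lookup_single when_def)
  then show ?thesis
    by (auto simp: in_keys_iff)
qed

lemma awlast_eq_if_awalk:
  assumes "pre_digraph.awalk Q u p v"
  shows "pre_digraph.awlast Q u p = v"
proof -
  have "pre_digraph.cas Q u p v \<Longrightarrow> last (pre_digraph.awalk_verts Q u p) = v"
    by (induction p arbitrary: u)
       (auto simp: pre_digraph.cas.simps pre_digraph.awalk_verts.simps pre_digraph.awalk_verts_non_Nil)
  then show ?thesis
    using assms by (simp add: pre_digraph.awalk_def)
qed

text \<open>
  Multiplying by \<open>e\<^sub>i\<close> on the left and by \<open>e\<^sub>j\<close> on the right only deletes terms: it keeps those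
  paths that start at \<open>i\<close> and end at \<open>j\<close>.  So an element supported on such paths is its own
  preimage.
\<close>

lemma peirce_component_eq_supported_on_walks:
  "peirce_component Q i j m
     = {y. Poly_Mapping.keys y \<subseteq> Pair i ` walks Q i j m}" (is "?L = ?R")
proof (intro subset_antisym subsetI)
  fix y :: "('a \<times> 'b list) \<Rightarrow>\<^sub>0 'c"
  assume "y \<in> ?L"
  then obtain x where x: "Poly_Mapping.keys x \<subseteq> qpaths Q"
      and y: "y = path_mult Q (path_mult Q (trivial_path i) x) (trivial_path j)"
      and len: "\<And>u p. (u, p) \<in> Poly_Mapping.keys y \<Longrightarrow> length p = m"
    unfolding peirce_component_def path_algebra_def by fast
  have "(u, p) \<in> Pair i ` walks Q i j m" if k: "(u, p) \<in> Poly_Mapping.keys y" for u p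
  proof -
    have "Poly_Mapping.lookup y (u, p) \<noteq> 0"
      using k by (simp add: in_keys_iff)
    then have "u = i" and "pre_digraph.awlast Q u p = j" and "(u, p) \<in> Poly_Mapping.keys x"
      unfolding y lookup_trivial_path_mult_right lookup_trivial_path_mult_left
      by (auto simp: in_keys_iff split: if_splits)
    then show ?thesis
      using x len[OF k] by (auto simp: qpaths_def walks_def dest: awlast_eq_if_awalk)
  qed
  then show "y \<in> ?R"
    by auto
next
  fix y :: "('a \<times> 'b list) \<Rightarrow>\<^sub>0 'c"
  assume "y \<in> ?R"
  then have y: "u = i \<and> pre_digraph.awalk Q i p j \<and> length p = m"
    if "(u, p) \<in> Poly_Mapping.keys y" for u p
    using that by (auto simp: walks_def)
  have "Poly_Mapping.lookup (path_mult Q (path_mult Q (trivial_path i) y) (trivial_path j)) (u, p)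
      = Poly_Mapping.lookup y (u, p)" for u p
    unfolding lookup_trivial_path_mult_right lookup_trivial_path_mult_left
    using y[of u p] by (auto simp: in_keys_iff dest: awlast_eq_if_awalk)
  then have "y = path_mult Q (path_mult Q (trivial_path i) y) (trivial_path j)"
    by (intro poly_mapping_eqI) (simp add: split_paired_all)
  moreover have "y \<in> path_algebra Q"
    using y by (auto simp: path_algebra_def qpaths_def)
  ultimately show "y \<in> ?L"
    using y unfolding peirce_component_def by fast
qed

lemma dim_supported_on:
  fixes B :: "'p set"
  assumes "finite B"
  shows "path_space.dim {y :: 'p \<Rightarrow>\<^sub>0 'k::field. Poly_Mapping.keys y \<subseteq> B} = card B"
proof (rule path_space.dim_unique)
  let ?b = "\<lambda>w :: 'p. Poly_Mapping.single w (1::'k)"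
  have inj: "inj_on ?b B"
    by (intro inj_onI) (metis keys_single singleton_inject zero_neq_one)
  show "?b ` B \<subseteq> {y. Poly_Mapping.keys y \<subseteq> B}"
    by auto
  show "card (?b ` B) = card B"
    using inj by (rule card_image)
  have lin: "Poly_Mapping.lookup (\<Sum>w\<in>B. path_scale (c w) (?b w)) v = (if v \<in> B then c v else 0)"
    for c :: "'p \<Rightarrow> 'k" and v
  proof -
    have "Poly_Mapping.lookup (\<Sum>w\<in>B. path_scale (c w) (?b w)) v
        = (\<Sum>w\<in>B. if w = v then c w else 0)"
      by (auto simp: lookup_sum lookup_path_scale lookup_single when_def intro!: sum.cong)
    then show ?thesis
      using assms by simp
  qed
  show "{y. Poly_Mapping.keys y \<subseteq> B} \<subseteq> path_space.span (?b ` B)"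
  proof
    fix y :: "'p \<Rightarrow>\<^sub>0 'k"
    assume "y \<in> {y. Poly_Mapping.keys y \<subseteq> B}"
    then have "y = (\<Sum>w\<in>B. path_scale (Poly_Mapping.lookup y w) (?b w))"
      by (intro poly_mapping_eqI) (auto simp: lin in_keys_iff)
    also have "\<dots> \<in> path_space.span (?b ` B)"
      by (intro path_space.span_sum path_space.span_scale path_space.span_base imageI)
    finally show "y \<in> path_space.span (?b ` B)" .
  qed
  show "path_space.independent (?b ` B)"
  proof (rule path_space.independent_if_scalars_zero)
    show "finite (?b ` B)"
      using assms by simp
    fix c x
    assume "(\<Sum>x\<in>?b ` B. path_scale (c x) x) = 0" and x: "x \<in> ?b ` B"
    then have "(\<Sum>w\<in>B. path_scale (c (?b w)) (?b w)) = 0"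
      by (simp only: sum.reindex[OF inj] o_def)
    then have "(if v \<in> B then c (?b v) else 0) = 0" for v
      using lin[of "\<lambda>w. c (?b w)" v] by (simp only: lookup_zero)
    moreover obtain v where "v \<in> B" and "x = ?b v"
      using x by blast
    ultimately show "c x = 0"
      by metis
  qed
qed

lemma finite_walks:
  assumes "finite (arcs Q)"
  shows "finite (walks Q i j m)"
  by (rule finite_subset[OF _ finite_lists_length_eq[OF assms, of m]])
     (auto simp: walks_def pre_digraph.awalk_def)

lemma dim_peirce_component:
  assumes "finite (arcs Q)"
  shows "path_space.dim (peirce_component Q i j m :: (('v, 'e) qpath \<Rightarrow>\<^sub>0 'k::field) set)
    = card (walks Q i j m)"
  using finite_walks[OF assms, of i j m]
  by (simp add: peirce_component_eq_supported_on_walks dim_supported_on card_image inj_on_def)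

text \<open>
  A path starting at height \<open>h i\<close> can descend at most \<open>h i\<close> times.  This bound makes the sum over
  all degrees in \<^const>\<open>q_cartan\<close> finite.
\<close>

lemma length_awalk_le_height:
  fixes h :: "'v \<Rightarrow> nat"
  assumes "\<And>e. e \<in> arcs Q \<Longrightarrow> h (head Q e) < h (tail Q e)"
    and "pre_digraph.awalk Q i p j"
  shows "length p \<le> h i"
proof -
  have "set p \<subseteq> arcs Q \<Longrightarrow> pre_digraph.cas Q i p j \<Longrightarrow> length p \<le> h i"
  proof (induction p arbitrary: i)
    case (Cons e p)
    then have "length p \<le> h (head Q e)" and "h (head Q e) < h (tail Q e)" and "tail Q e = i"
      using assms(1) by (auto simp: pre_digraph.cas.simps)
    then show ?case
      by simp
  qed simp
  then show ?thesis
    using assms(2) by (simp add: pre_digraph.awalk_def)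
qed

lemma coeff_q_cartan:
  fixes Q :: "('n::finite, 'e) pre_digraph" and h :: "'n \<Rightarrow> nat"
  assumes "finite (arcs Q)" and h: "\<And>e. e \<in> arcs Q \<Longrightarrow> h (head Q e) < h (tail Q e)"
  shows "coeff (q_cartan TYPE('k::field) Q $ i $ j) m = int (card (walks Q i j m))"
proof -
  let ?c = "\<lambda>m. int (card (walks Q i j m))"
  have zero: "?c m = 0" if "m \<notin> {..h i}" for m
  proof -
    have "walks Q i j m = {}"
      using length_awalk_le_height[of Q h i _ j, OF h] that by (auto simp: walks_def)
    then show ?thesis
      by simp
  qed
  then have "Sum_any (\<lambda>m. monom (?c m) m) = (\<Sum>m\<le>h i. monom (?c m) m)"
    by (intro Sum_any.expand_superset) force+
  then show ?thesis
    using zero[of m]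
    by (simp add: q_cartan_def dim_peirce_component[OF assms(1)] coeff_sum)
qed

section \<open>Inverting the \<open>q\<close>-Cartan matrix\<close>

definition arrow_count :: "('v, 'e) pre_digraph \<Rightarrow> 'v \<Rightarrow> 'v \<Rightarrow> nat" where
  "arrow_count Q i j = card {e \<in> arcs Q. tail Q e = i \<and> head Q e = j}"

text \<open>
  At \<open>q = 1\<close> this is the Gram matrix of the Euler form of the quiver, whence the name.
\<close>

definition euler_matrix :: "('n::finite, 'e) pre_digraph \<Rightarrow> int poly ^ 'n ^ 'n" where
  "euler_matrix Q = (\<chi> i j. of_bool (i = j) - q_indet * of_nat (arrow_count Q i j))"

lemma coeff_q_indet_mult_of_nat:
  "coeff (q_indet * of_nat a * p) m = (case m of 0 \<Rightarrow> 0 | Suc k \<Rightarrow> int a * coeff p k)"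
proof -
  have "q_indet * of_nat a = monom (int a) 1"
    by (simp only: q_indet_def of_nat_poly) (simp add: smult_monom mult.commute)
  then show ?thesis
    by (cases m) (simp_all add: coeff_monom_mult)
qed

lemma euler_matrix_mult_nth:
  "(euler_matrix Q ** X) $ i $ j
     = X $ i $ j - (\<Sum>k\<in>UNIV. q_indet * of_nat (arrow_count Q i k) * X $ k $ j)"
  by (simp add: euler_matrix_def matrix_matrix_mult_def left_diff_distrib sum_subtractf of_bool_def
      if_distrib[of "\<lambda>x. x * _"] cong: if_cong)

text \<open>A walk of length \<open>m + 1\<close> is a first arrow followed by a walk of length \<open>m\<close>.\<close>

lemma card_walks_Suc:
  fixes Q :: "('n::finite, 'e) pre_digraph"
  assumes "finite (arcs Q)" and "verts Q = UNIV"
  shows "card (walks Q i j (Suc m)) = (\<Sum>k\<in>UNIV. arrow_count Q i k * card (walks Q k j m))"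
proof -
  let ?E = "\<lambda>k. {e \<in> arcs Q. tail Q e = i \<and> head Q e = k}"
  have "walks Q i j (Suc m) = (\<Union>k\<in>UNIV. (\<lambda>(e, p). e # p) ` (?E k \<times> walks Q k j m))"
    using assms(2)
    by (fastforce simp: walks_def pre_digraph.awalk_def length_Suc_conv pre_digraph.cas.simps)
  also have "card \<dots> = (\<Sum>k\<in>UNIV. card ((\<lambda>(e, p). e # p) ` (?E k \<times> walks Q k j m)))"
    using assms(1) finite_walks[OF assms(1)] by (intro card_UN_disjoint) auto
  also have "\<dots> = (\<Sum>k\<in>UNIV. arrow_count Q i k * card (walks Q k j m))"
    by (simp add: card_image inj_on_def card_cartesian_product arrow_count_def)
  finally show ?thesis .
qed

text \<open>
  In degree \<open>0\<close> only the trivial paths contribute, which gives the identity matrix; in each positive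
  degree the recursion on the first arrow makes the two terms of \<open>C - qA C\<close> cancel.
\<close>

lemma euler_matrix_mult_q_cartan:
  fixes Q :: "('n::finite, 'e) pre_digraph" and h :: "'n \<Rightarrow> nat"
  assumes "finite (arcs Q)" and "verts Q = UNIV"
    and h: "\<And>e. e \<in> arcs Q \<Longrightarrow> h (head Q e) < h (tail Q e)"
  shows "euler_matrix Q ** q_cartan TYPE('k::field) Q = mat 1"
proof -
  have "coeff ((euler_matrix Q ** q_cartan TYPE('k) Q) $ i $ j) m
      = coeff ((mat 1 :: int poly ^ 'n ^ 'n) $ i $ j) m" for i j m
  proof (cases m)
    case 0
    have "walks Q i j 0 = (if i = j then {[]} else {})"
      using assms(2) by (auto simp: walks_def pre_digraph.awalk_def pre_digraph.cas.simps)
    then show ?thesis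
      using 0 by (simp add: euler_matrix_mult_nth coeff_sum coeff_q_indet_mult_of_nat
          coeff_q_cartan[OF assms(1) h] mat_def)
  next
    case (Suc m')
    then show ?thesis
      by (simp add: euler_matrix_mult_nth coeff_sum coeff_q_indet_mult_of_nat
          coeff_q_cartan[OF assms(1) h] card_walks_Suc[OF assms(1,2)] mat_def)
  qed
  then show ?thesis
    by (simp add: vec_eq_iff poly_eq_iff)
qed

text \<open>
  Row \<open>i\<close> of \<open>X\<close> is row \<open>i\<close> of \<open>M X\<close> plus a combination of rows of \<open>X\<close> at vertices of smaller
  height, so \<open>M X\<close> determines \<open>X\<close> by induction on the height.
\<close>

lemma euler_matrix_left_cancel:
  fixes Q :: "('n::finite, 'e) pre_digraph" and h :: "'n \<Rightarrow> nat"
  assumes h: "\<And>e. e \<in> arcs Q \<Longrightarrow> h (head Q e) < h (tail Q e)"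
    and XY: "euler_matrix Q ** X = euler_matrix Q ** Y"
  shows "X = Y"
proof -
  have "X $ i $ j = Y $ i $ j" for i j
  proof (induction "h i" arbitrary: i rule: less_induct)
    case less
    have "q_indet * of_nat (arrow_count Q i k) * X $ k $ j
        = q_indet * of_nat (arrow_count Q i k) * Y $ k $ j" for k
    proof (cases "arrow_count Q i k = 0")
      case False
      then obtain e where "e \<in> arcs Q" "tail Q e = i" "head Q e = k"
        unfolding arrow_count_def by (metis (mono_tags, lifting) Collect_empty_eq card.empty)
      then show ?thesis
        using less h by fastforce
    qed simp
    then have "(\<Sum>k\<in>UNIV. q_indet * of_nat (arrow_count Q i k) * X $ k $ j)
        = (\<Sum>k\<in>UNIV. q_indet * of_nat (arrow_count Q i k) * Y $ k $ j)"
      by (intro sum.cong refl)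
    moreover have "(euler_matrix Q ** X) $ i $ j = (euler_matrix Q ** Y) $ i $ j"
      by (simp only: XY)
    ultimately show ?case
      by (simp add: euler_matrix_mult_nth)
  qed
  then show ?thesis
    by (simp add: vec_eq_iff)
qed

text \<open>
  As \<open>C\<close> is a right inverse of \<open>M\<close>, we have \<open>M (C M) = M\<close>, and \<open>M\<close> can be cancelled on the left.
\<close>

lemma q_cartan_mult_euler_matrix:
  fixes Q :: "('n::finite, 'e) pre_digraph" and h :: "'n \<Rightarrow> nat"
  assumes "finite (arcs Q)" and "verts Q = UNIV"
    and h: "\<And>e. e \<in> arcs Q \<Longrightarrow> h (head Q e) < h (tail Q e)"
  shows "q_cartan TYPE('k::field) Q ** euler_matrix Q = mat 1"
proof -
  have "euler_matrix Q ** (q_cartan TYPE('k) Q ** euler_matrix Q) = euler_matrix Q ** mat 1"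
    by (simp add: matrix_mul_assoc euler_matrix_mult_q_cartan[OF assms])
  then show ?thesis
    using euler_matrix_left_cancel[of Q h, OF h] by blast
qed

section \<open>Products of \<open>q\<close>-reflections\<close>

lemma edge_count_eq_0:
  assumes "l \<noteq> a" and "l \<notin> neighbours \<Gamma> a"
  shows "edge_count \<Gamma> l a = 0"
proof -
  have "{e \<in> edges \<Gamma>. ends \<Gamma> e = {l, a}} = {}"
    using assms by (auto simp: neighbours_def insert_commute)
  then show ?thesis
    by (simp add: edge_count_def del: Collect_empty_eq)
qed

lemma q_reflection_matrix_nth:
  "q_reflection_matrix \<Gamma> a $ k $ l =
     (if k \<noteq> a then of_bool (k = l)
      else if l = a then - 1 else q_indet * of_nat (edge_count \<Gamma> l a))"
proof -
  have "(\<Sum>j\<in>neighbours \<Gamma> a. of_nat (edge_count \<Gamma> j a) * (axis l 1 :: int poly ^ 'a) $ j)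
      = (\<Sum>j\<in>neighbours \<Gamma> a. if j = l then of_nat (edge_count \<Gamma> j a) else 0)"
    by (intro sum.cong refl) (auto simp: axis_def)
  also have "\<dots> = (if l = a then 0 else of_nat (edge_count \<Gamma> l a))"
    using edge_count_eq_0[of l a \<Gamma>] by (auto simp: neighbours_def)
  finally have *: "(\<Sum>j\<in>neighbours \<Gamma> a. of_nat (edge_count \<Gamma> j a) * (axis l 1 :: int poly ^ 'a) $ j)
      = (if l = a then 0 else of_nat (edge_count \<Gamma> l a))" .
  show ?thesis
    by (simp add: q_reflection_matrix_def matrix_def q_reflection_def sum_component *
        flip: sum_distrib_right) (auto simp: axis_def)
qed

lemma q_reflection_matrix_mult_nth_other:
  "k \<noteq> a \<Longrightarrow> (q_reflection_matrix \<Gamma> a ** M) $ k $ j = M $ k $ j"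
  by (simp add: matrix_matrix_mult_def q_reflection_matrix_nth of_bool_def
      if_distrib[of "\<lambda>x. x * _"] cong: if_cong)

lemma q_reflection_matrix_mult_nth_self:
  "(q_reflection_matrix \<Gamma> a ** M) $ a $ j
     = - M $ a $ j + (\<Sum>l\<in>UNIV - {a}. q_indet * of_nat (edge_count \<Gamma> l a) * M $ l $ j)"
  by (simp add: matrix_matrix_mult_def q_reflection_matrix_nth sum.remove[of UNIV a])

lemma q_coxeter_Cons: "q_coxeter \<Gamma> (a # as) = q_reflection_matrix \<Gamma> a ** q_coxeter \<Gamma> as"
  by (simp add: q_coxeter_def)

lemma q_coxeter_append_nth:
  "i \<notin> set as \<Longrightarrow> q_coxeter \<Gamma> (as @ bs) $ i $ j = q_coxeter \<Gamma> bs $ i $ j"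
  by (induction as) (auto simp: q_coxeter_Cons q_reflection_matrix_mult_nth_other)

lemma q_coxeter_nth_notin:
  "i \<notin> set as \<Longrightarrow> q_coxeter \<Gamma> as $ i $ j = of_bool (i = j)"
  using q_coxeter_append_nth[of i as \<Gamma> "[]"] by (simp add: q_coxeter_def mat_def)

text \<open>
  Row \<open>i\<close> of the product is produced by the reflection at \<open>i\<close>, applied to the product over \<open>bs\<close>.
  The rows of that product at vertices of \<open>bs\<close> are already final, since the remaining reflections
  leave them alone; its other rows are those of the identity.
\<close>

lemma q_coxeter_row:
  assumes "distinct (as @ i # bs)"
  shows "q_coxeter \<Gamma> (as @ i # bs) $ i $ j = - of_bool (i = j) +
    (\<Sum>l\<in>UNIV - {i}. q_indet * of_nat (edge_count \<Gamma> l i) *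
       (if l \<in> set bs then q_coxeter \<Gamma> (as @ i # bs) $ l $ j else of_bool (l = j)))"
proof -
  have "q_coxeter \<Gamma> bs $ l $ j
      = (if l \<in> set bs then q_coxeter \<Gamma> (as @ i # bs) $ l $ j else of_bool (l = j))" for l
  proof (cases "l \<in> set bs")
    case True
    then have "l \<notin> set (as @ [i])"
      using assms by auto
    then have "q_coxeter \<Gamma> ((as @ [i]) @ bs) $ l $ j = q_coxeter \<Gamma> bs $ l $ j"
      by (rule q_coxeter_append_nth)
    then show ?thesis
      using True by simp
  qed (simp add: q_coxeter_nth_notin)
  then show ?thesis
    using assms
    by (simp add: q_coxeter_append_nth q_coxeter_Cons q_reflection_matrix_mult_nth_self
        q_coxeter_nth_notin)
qed

section \<open>Admissible numberings\<close>

lemma admissible_numbering_head_before: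
  assumes "admissible_numbering Q (as @ i # bs)" and "verts Q = UNIV"
    and "e \<in> arcs Q" and "tail Q e = i"
  shows "head Q e \<in> set as"
proof -
  have "is_sink (Q \<restriction> (UNIV - set as)) i"
    using assms(1,2) unfolding admissible_numbering_def
    by (metis add_Suc_right append_eq_conv_conj length_Cons length_append less_add_Suc1 nth_append_length)
  moreover have "i \<notin> set as"
    using assms(1) by (simp add: admissible_numbering_def)
  ultimately show ?thesis
    using assms(3,4) by (auto simp: is_sink_def out_arcs_def)
qed

text \<open>
  The position in the numbering is a height function.  It is written as the length of a
  \<^const>\<open>takeWhile\<close> prefix because the prefix for the tail of an arrow contains the head.
\<close>

lemma admissible_numbering_height:
  fixes Q :: "('v, 'e) pre_digraph"
  assumes "admissible_numbering Q as" and "verts Q = UNIV"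
  obtains h :: "'v \<Rightarrow> nat" where "\<And>e. e \<in> arcs Q \<Longrightarrow> h (head Q e) < h (tail Q e)"
proof
  fix e assume e: "e \<in> arcs Q"
  obtain bs cs where as: "as = bs @ tail Q e # cs" and "tail Q e \<notin> set bs"
    using assms by (metis UNIV_I admissible_numbering_def split_list_first)
  have "head Q e \<in> set bs"
    using admissible_numbering_head_before assms e as by metis
  then obtain bs' bs'' where "bs = bs' @ head Q e # bs''" and "head Q e \<notin> set bs'"
    by (metis split_list_first)
  then show "length (takeWhile ((\<noteq>) (head Q e)) as) < length (takeWhile ((\<noteq>) (tail Q e)) as)"
    using as \<open>tail Q e \<notin> set bs\<close> by (auto simp: takeWhile_append)
qed

text \<open>
  All edges between \<open>i\<close> and \<open>l\<close> are arrows from the later vertex to the earlier one.  The two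
  vanishing counts allow both kinds of arrow to be summed over all vertices.
\<close>

lemma edge_count_admissible:
  assumes "orientation_of Q \<Gamma>" and "admissible_numbering Q (as @ i # bs)" and "l \<noteq> i"
  shows "edge_count \<Gamma> l i = (if l \<in> set bs then arrow_count Q l i else arrow_count Q i l)"
    and "l \<in> set bs \<Longrightarrow> arrow_count Q i l = 0"
    and "l \<notin> set bs \<Longrightarrow> arrow_count Q l i = 0"
proof -
  have Q: "verts Q = UNIV" "arcs Q = edges \<Gamma>"
      "\<And>e. e \<in> arcs Q \<Longrightarrow> ends \<Gamma> e = {tail Q e, head Q e}"
    using assms(1) by (auto simp: orientation_of_def)
  have d: "distinct (as @ i # bs)" "set (as @ i # bs) = UNIV"
    using assms(2) Q(1) by (auto simp: admissible_numbering_def)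
  have no_out: "head Q e \<noteq> l" if "l \<in> set bs" "e \<in> arcs Q" "tail Q e = i" for e
    using admissible_numbering_head_before[OF assms(2) Q(1)] d that by auto
  have no_in: "head Q e \<noteq> i" if l: "l \<notin> set bs" and e: "e \<in> arcs Q" "tail Q e = l" for e
  proof -
    have "l \<in> set as"
      using l d assms(3) by auto
    then obtain as' as'' where as: "as = as' @ l # as''"
      by (metis split_list)
    have "head Q e \<in> set as'"
      using admissible_numbering_head_before[of Q as' l "as'' @ i # bs"] assms(2) Q(1) e as by simp
    then show ?thesis
      using d as by auto
  qed
  show "l \<in> set bs \<Longrightarrow> arrow_count Q i l = 0"
    using no_out by (auto simp: arrow_count_def card_eq_0_iff)
  show "l \<notin> set bs \<Longrightarrow> arrow_count Q l i = 0"
    using no_in by (auto simp: arrow_count_def card_eq_0_iff)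
  have "ends \<Gamma> e = {l, i} \<longleftrightarrow>
      (if l \<in> set bs then tail Q e = l \<and> head Q e = i else tail Q e = i \<and> head Q e = l)"
    if "e \<in> arcs Q" for e
    using Q(3)[OF that] no_out[of e] no_in[of e] that by (auto simp: doubleton_eq_iff)
  then have "{e \<in> arcs Q. ends \<Gamma> e = {l, i}} = {e \<in> arcs Q.
      if l \<in> set bs then tail Q e = l \<and> head Q e = i else tail Q e = i \<and> head Q e = l}"
    by blast
  then show "edge_count \<Gamma> l i = (if l \<in> set bs then arrow_count Q l i else arrow_count Q i l)"
    by (simp add: edge_count_def arrow_count_def Q(2))
qed

text \<open>
  The row formula for \<open>\<Phi>\<close> splits its neighbours into later ones, which contribute \<open>q A\<^sup>T \<Phi>\<close>, and
  earlier ones, which contribute \<open>q A\<close>; so it reads \<open>\<Phi> = - 1 + q A\<^sup>T \<Phi> + q A\<close>.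
\<close>

lemma transpose_euler_matrix_mult_q_coxeter:
  fixes Q :: "('n::finite, 'e) pre_digraph" and h :: "'n \<Rightarrow> nat"
  assumes o: "orientation_of Q \<Gamma>" and adm: "admissible_numbering Q as"
    and h: "\<And>e. e \<in> arcs Q \<Longrightarrow> h (head Q e) < h (tail Q e)"
  shows "transpose (euler_matrix Q) ** q_coxeter \<Gamma> as = - euler_matrix Q"
proof -
  let ?\<Phi> = "q_coxeter \<Gamma> as"
  have loop: "arrow_count Q i i = 0" for i
    using h by (force simp: arrow_count_def card_eq_0_iff)
  have "(transpose (euler_matrix Q) ** ?\<Phi>) $ i $ j = - euler_matrix Q $ i $ j" for i j
  proof -
    have "i \<in> set as" and "distinct as"
      using adm o by (auto simp: admissible_numbering_def orientation_of_def)
    then obtain bs cs where as: "as = bs @ i # cs"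
      by (metis split_list)
    note ec = edge_count_admissible[OF o adm[unfolded as]]
    have "?\<Phi> $ i $ j = - of_bool (i = j) +
        (\<Sum>l\<in>UNIV - {i}. q_indet * of_nat (edge_count \<Gamma> l i) *
           (if l \<in> set cs then ?\<Phi> $ l $ j else of_bool (l = j)))"
      using q_coxeter_row[of bs i cs \<Gamma> j, folded as] \<open>distinct as\<close> by blast
    also have "(\<Sum>l\<in>UNIV - {i}. q_indet * of_nat (edge_count \<Gamma> l i) *
           (if l \<in> set cs then ?\<Phi> $ l $ j else of_bool (l = j)))
        = (\<Sum>l\<in>UNIV - {i}. q_indet * of_nat (arrow_count Q l i) * ?\<Phi> $ l $ j
             + q_indet * of_nat (arrow_count Q i l) * of_bool (l = j))"
      using ec by (intro sum.cong) auto
    also have "\<dots> = (\<Sum>l\<in>UNIV. q_indet * of_nat (arrow_count Q l i) * ?\<Phi> $ l $ j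
             + q_indet * of_nat (arrow_count Q i l) * of_bool (l = j))"
      by (simp add: sum.remove[of UNIV i] loop)
    also have "\<dots> = (\<Sum>l\<in>UNIV. q_indet * of_nat (arrow_count Q l i) * ?\<Phi> $ l $ j)
             + q_indet * of_nat (arrow_count Q i j)"
      by (simp add: sum.distrib of_bool_def if_distrib[of "\<lambda>x. _ * x"] cong: if_cong)
    finally have "?\<Phi> $ i $ j - (\<Sum>l\<in>UNIV. q_indet * of_nat (arrow_count Q l i) * ?\<Phi> $ l $ j)
        = - euler_matrix Q $ i $ j"
      by (simp add: euler_matrix_def)
    moreover have "(transpose (euler_matrix Q) ** ?\<Phi>) $ i $ j
        = ?\<Phi> $ i $ j - (\<Sum>l\<in>UNIV. q_indet * of_nat (arrow_count Q l i) * ?\<Phi> $ l $ j)"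
      by (simp add: euler_matrix_def matrix_matrix_mult_def transpose_def left_diff_distrib
          sum_subtractf of_bool_def if_distrib[of "\<lambda>x. x * _"] cong: if_cong)
    ultimately show ?thesis
      by simp
  qed
  then show ?thesis
    by (simp add: vec_eq_iff)
qed

theorem theorem4p2:
  fixes \<Gamma> :: "('n::finite, 'e) multigraph"
    and Q :: "('n, 'e) pre_digraph"
    and as :: "'n list"
  defines "C \<equiv> q_cartan TYPE('k::alg_closed_field) Q"
    and "\<Phi> \<equiv> q_coxeter \<Gamma> as"
  assumes "finite_multigraph \<Gamma>"
    and "orientation_of Q \<Gamma>"
    and "acyclic_quiver Q"
    and "admissible_numbering Q as"
  shows "transpose C = - (\<Phi> ** C) \<and> invertible C \<and> \<Phi> = - (transpose C ** matrix_inv C)"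
proof -
  let ?M = "euler_matrix Q"
  have Q: "verts Q = UNIV" "finite (arcs Q)"
    using assms(3,4) by (auto simp: orientation_of_def finite_multigraph_def)
  obtain h :: "'n \<Rightarrow> nat" where h: "\<And>e. e \<in> arcs Q \<Longrightarrow> h (head Q e) < h (tail Q e)"
    using admissible_numbering_height[OF assms(6) Q(1)] by blast
  have MC: "?M ** C = mat 1" and CM: "C ** ?M = mat 1"
    unfolding C_def
    using euler_matrix_mult_q_cartan[OF Q(2,1) h] q_cartan_mult_euler_matrix[OF Q(2,1) h] by auto
  have inv: "invertible C"
    using MC CM invertible_def by blast
  have "matrix_inv C = ?M"
    unfolding matrix_inv_def
  proof (rule some_equality)
    show "C ** ?M = mat 1 \<and> ?M ** C = mat 1"
      using MC CM by blast
  next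
    fix N assume N: "C ** N = mat 1 \<and> N ** C = mat 1"
    then have "N = N ** (C ** ?M)"
      by (simp add: CM)
    also have "\<dots> = ?M"
      using N by (simp add: matrix_mul_assoc)
    finally show "N = ?M" .
  qed
  have "transpose C ** transpose ?M = mat 1"
    by (metis MC matrix_transpose_mul transpose_mat)
  then have \<Phi>: "\<Phi> = transpose C ** (- ?M)"
    unfolding \<Phi>_def
    using transpose_euler_matrix_mult_q_coxeter[OF assms(4,6) h]
    by (metis matrix_mul_assoc matrix_mul_lid)
  have neg: "X ** (- Y) = - (X ** Y)" "(- X) ** Y = - (X ** Y)" for X Y :: "int poly ^ 'n ^ 'n"
    by (simp_all add: matrix_matrix_mult_def vec_eq_iff sum_negf)
  have "\<Phi> ** C = - (transpose C ** (?M ** C))"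
    by (simp add: \<Phi> neg matrix_mul_assoc)
  then have "transpose C = - (\<Phi> ** C)"
    by (simp add: MC)
  moreover have "\<Phi> = - (transpose C ** matrix_inv C)"
    by (simp add: \<Phi> neg \<open>matrix_inv C = ?M\<close>)
  ultimately show ?thesis
    using inv by blast
qed

end
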